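(* Let $X\subseteq\mathbb{N}^2$ be standardization-invariant. Let $I=\{i_1<i_2<\cdots<i_k\}\subseteq[n-1]$, set $i_0=0$, and let $n\ge\max(I)$. Then \[ d_X(I;n)=\sum_{\{j_1<\cdots<j_r\}\subseteq\{1,\dots,k\}}(-1)^{k-r}\binom{n}{i_{j_r}}\binom{i_{j_r}}{i_{j_{r-1}}}\cdots\binom{i_{j_2}}{i_{j_1}}\prod_{t=0}^{r} d_X\bigl(\emptyset;\,i_{j_{t+1}}-i_{j_t}\bigr), \] where $j_0=0$, $j_{r+1}=k+1$, $i_{k+1}=n$; when $r=0$ the (empty) product of binomial coefficients is $1$ and the last product is $d_X(\emptyset;n)$.
   Context: $[n]=\{1,\dots,n\}$. For finite $S\subseteq\mathbb{N}$ with $|S|=n$, $\mathfrak{S}_S$ is the set of bijections $\pi:[n]\to S$ in one-line notation $\pi_1\cdots\pi_n$; $\mathrm{XDes}(\pi)=\{i\in[n-1]:(\pi_i,\pi_{i+1})\in X\}$; $d_X(I;S)$ is the number of $\pi\in\mathfrak{S}_S$ with $\mathrm{XDes}(\pi)=I$, and $d_X(I;n)=d_X(I;[n])$. $X$ is standardization-invariant if for every finite $S\subseteq\mathbb{N}$ and every $I$, $d_X(I;S)$ depends only on $|S|$ (so $d_X(I;S)=d_X(I;|S|)$). *)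

theory Defs
  imports Complex_Main "HOL-Library.FuncSet"
begin

text \<open>
  The letters are positive integers, in accordance with \<open>[n] = {1, \<dots>, n}\<close>. Words never contain
  the letter 0, so pairs of \<open>X\<close> involving 0 play no role.
\<close>

definition words :: "nat set \<Rightarrow> (nat \<Rightarrow> nat) set" where
  "words S = {p \<in> {1..card S} \<rightarrow>\<^sub>E S. bij_betw p {1..card S} S}"

definition XDes :: "(nat \<times> nat) set \<Rightarrow> nat \<Rightarrow> (nat \<Rightarrow> nat) \<Rightarrow> nat set" where
  "XDes X n p = {i \<in> {1..n - 1}. (p i, p (i + 1)) \<in> X}"

definition dX_set :: "(nat \<times> nat) set \<Rightarrow> nat set \<Rightarrow> nat set \<Rightarrow> nat" where
  "dX_set X I S = card {p \<in> words S. XDes X (card S) p = I}"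

definition dX :: "(nat \<times> nat) set \<Rightarrow> nat set \<Rightarrow> nat \<Rightarrow> nat" where
  "dX X I n = dX_set X I {1..n}"

definition standardization_invariant :: "(nat \<times> nat) set \<Rightarrow> bool" where
  "standardization_invariant X \<longleftrightarrow>
     (\<forall>I S T. finite S \<and> finite T \<and> S \<subseteq> {1..} \<and> T \<subseteq> {1..} \<and> card S = card T
        \<longrightarrow> dX_set X I S = dX_set X I T)"

text \<open>
  For \<open>J = {j\<^sub>1 < \<dots> < j\<^sub>r}\<close>, the value \<open>padded_enum m J t\<close> is \<open>j\<^sub>t\<close> for \<open>0 \<le> t \<le> r + 1\<close>,
  with the conventions \<open>j\<^sub>0 = 0\<close> and \<open>j\<^sub>r\<^sub>+\<^sub>1 = m\<close>.
\<close>

definition padded_enum :: "nat \<Rightarrow> nat set \<Rightarrow> nat \<Rightarrow> nat" where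
  "padded_enum m J t = (0 # sorted_list_of_set J @ [m]) ! t"

end

theory Submission
  imports Defs
begin

text \<open>
  Let \<open>\<alpha>(J; S)\<close> count the words on \<open>S\<close> with \<open>XDes \<subseteq> J\<close>. If \<open>m\<close> exceeds all elements of \<open>J\<close>, cutting a
  word after position \<open>m\<close> identifies the words counted by \<open>\<alpha>(J \<union> {m}; S)\<close> with triples of a subset
  \<open>T\<close> of \<open>S\<close> of size \<open>m\<close>, a word on \<open>T\<close> with \<open>XDes \<subseteq> J\<close>, and a word on \<open>S - T\<close> with \<open>XDes = \<emptyset>\<close>. By
  standardization invariance the last two counts do not depend on \<open>T\<close>, so \<open>\<alpha>(J; [n])\<close> is a product of
  binomial coefficients and values \<open>d\<^sub>X(\<emptyset>; \<cdot>)\<close>. Moebius inversion over the subsets of \<open>I\<close> recovers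
  \<open>d\<^sub>X(I; n)\<close>.
\<close>

lemma words_bij: "p \<in> words S \<Longrightarrow> bij_betw p {1..card S} S"
  by (simp add: words_def)

lemma words_extensional: "p \<in> words S \<Longrightarrow> p \<in> extensional {1..card S}"
  by (auto simp: words_def PiE_def)

lemma wordsI: "p \<in> extensional {1..card S} \<Longrightarrow> bij_betw p {1..card S} S \<Longrightarrow> p \<in> words S"
  by (auto simp: words_def PiE_def dest: bij_betwE)

lemma finite_words: "finite S \<Longrightarrow> finite (words S)"
  unfolding words_def by (simp add: finite_PiE)

text \<open>The pair of letters at positions m and m + 1 straddles the cut and belongs to neither
  half, so position m is left unconstrained, which is what \<open>insert m J\<close> allows. Every
  other position lies wholly in one half. Since J stays below m, the right half must have an empty
  descent set. Fixing the letters T of the left half makes concatenation the inverse.\<close>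

lemma bij_betw_split_word:
  assumes S: "finite S" "card S = n" and T: "T \<subseteq> S" "card T = m"
    and m: "1 \<le> m" and J: "J \<subseteq> {1..<m}"
  shows "bij_betw (\<lambda>p. (restrict p {1..m}, \<lambda>i\<in>{1..n - m}. p (i + m)))
     {p \<in> words S. p ` {1..m} = T \<and> XDes X n p \<subseteq> insert m J}
     ({q \<in> words T. XDes X m q \<subseteq> J} \<times> {r \<in> words (S - T). XDes X (n - m) r \<subseteq> {}})"
    (is "bij_betw ?f ?A (?B \<times> ?C)")
\<comment> \<open>The inverse concatenates q and r. The outer restriction to {1..n} makes the result
  extensional, as membership in \<open>words S\<close> demands.\<close>
proof (rule bij_betwI[where g = "\<lambda>(q, r). \<lambda>i\<in>{1..n}. if i \<le> m then q i else r (i - m)"])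
  have mn: "m \<le> n" using S T by (metis card_mono)
  have fT: "finite T" using S T by (metis finite_subset)
  have cST: "card (S - T) = n - m" using S T fT by (simp add: card_Diff_subset)
  have im: "(\<lambda>i. i + m) ` {1..n - m} = {1..n} - {1..m}"
    using mn by (auto simp: image_iff intro: bexI[where x = "_ - m"])
  have bs: "bij_betw (\<lambda>i. i + m) {1..n - m} ({1..n} - {1..m})"
    unfolding bij_betw_def im by (simp add: inj_on_def)
  show "?f \<in> ?A \<rightarrow> ?B \<times> ?C"
  proof
    fix p assume "p \<in> ?A"
    then have p: "p \<in> words S" and pT: "p ` {1..m} = T" and D: "XDes X n p \<subseteq> insert m J" by auto
    have bp: "bij_betw p {1..n} S" using words_bij[OF p] S by simp
    then have inj: "inj_on p {1..n}" and ims: "p ` {1..n} = S" by (auto simp: bij_betw_def)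
    have b1: "bij_betw p {1..m} T"
      using inj pT mn by (auto simp: bij_betw_def intro: inj_on_subset)
    have "p ` ({1..n} - {1..m}) = S - T"
      using inj_on_image_set_diff[OF inj, of "{1..n}" "{1..m}"] ims pT mn by simp
    then have "bij_betw p ({1..n} - {1..m}) (S - T)"
      using inj by (auto simp: bij_betw_def intro: inj_on_subset)
    then have b2: "bij_betw (p \<circ> (\<lambda>i. i + m)) {1..n - m} (S - T)"
      using bs bij_betw_trans by blast
    have "restrict p {1..m} \<in> words T"
      by (rule wordsI) (simp_all only: T(2) bij_betw_restrict_eq b1 restrict_extensional)
    moreover have "(\<lambda>i\<in>{1..n - m}. p (i + m)) \<in> words (S - T)"
      by (rule wordsI) (use b2 in \<open>simp_all only: cST bij_betw_restrict_eq o_def restrict_extensional\<close>)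
    moreover have "XDes X m (restrict p {1..m}) \<subseteq> J"
    proof
      fix x assume "x \<in> XDes X m (restrict p {1..m})"
      then have x: "1 \<le> x" "x < m" "(p x, p (x + 1)) \<in> X"
        by (auto simp: XDes_def split: if_splits)
      then have "x \<in> XDes X n p" using mn by (auto simp: XDes_def)
      then show "x \<in> J" using D x by auto
    qed
    moreover have "XDes X (n - m) (\<lambda>i\<in>{1..n - m}. p (i + m)) \<subseteq> {}"
    proof
      fix x assume "x \<in> XDes X (n - m) (\<lambda>i\<in>{1..n - m}. p (i + m))"
      then have x: "1 \<le> x" "x < n - m" "(p (x + m), p (x + m + 1)) \<in> X"
        by (auto simp: XDes_def split: if_splits)
      then have "x + m \<in> XDes X n p" by (auto simp: XDes_def)
      \<comment> \<open>Here x >= 1 excludes x + m = m; an element of J beyond m then contradicts J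
        < m.\<close>
      then have "x + m \<in> J" using D x by auto
      then show "x \<in> {}" using J by auto
    qed
    ultimately show "?f p \<in> ?B \<times> ?C" by simp
  qed
  show "(\<lambda>(q, r). \<lambda>i\<in>{1..n}. if i \<le> m then q i else r (i - m)) \<in> ?B \<times> ?C \<rightarrow> ?A"
  proof
    fix y assume "y \<in> ?B \<times> ?C"
    then obtain q r where y: "y = (q, r)"
      and q: "q \<in> words T" and r: "r \<in> words (S - T)"
      and Dq: "XDes X m q \<subseteq> J" and Dr: "XDes X (n - m) r \<subseteq> {}" by blast
    let ?p = "\<lambda>i\<in>{1..n}. if i \<le> m then q i else r (i - m)"
    have bq: "bij_betw q {1..m} T" using words_bij[OF q] T by simp
    have br: "bij_betw r {1..n - m} (S - T)" using words_bij[OF r] cST by simp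
    have b1: "bij_betw ?p {1..m} T"
      using bq by (rule bij_betw_cong[THEN iffD1, rotated]) (use mn in auto)
    have bs': "bij_betw (\<lambda>i. i - m) ({1..n} - {1..m}) {1..n - m}"
      by (rule bij_betwI[where g = "\<lambda>i. i + m"]) (use mn in auto)
    have "bij_betw (r \<circ> (\<lambda>i. i - m)) ({1..n} - {1..m}) (S - T)"
      using bij_betw_trans[OF bs' br] .
    then have b2: "bij_betw ?p ({1..n} - {1..m}) (S - T)"
      by (rule bij_betw_cong[THEN iffD1, rotated]) auto
    have "bij_betw ?p ({1..m} \<union> ({1..n} - {1..m})) (T \<union> (S - T))"
      by (rule bij_betw_combine[OF b1 b2]) auto
    moreover have "{1..m} \<union> ({1..n} - {1..m}) = {1..n}" using mn by auto
    moreover have "T \<union> (S - T) = S" using T by auto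
    ultimately have "bij_betw ?p {1..n} S" by simp
    then have "?p \<in> words S" by (intro wordsI) (use S in simp_all)
    moreover have "?p ` {1..m} = T" using b1 by (simp add: bij_betw_def)
    moreover have "x \<in> J" if "x \<in> XDes X n ?p" "x \<noteq> m" for x
    proof (cases "x < m")
      case True
      then have "x \<in> XDes X m q" using that mn by (auto simp: XDes_def)
      then show ?thesis using Dq by auto
    next
      case False
      \<comment> \<open>Now x > m, so x and x + 1 are both past the cut and are read in r at x - m
        and x - m + 1.\<close>
      then have "x - m \<in> XDes X (n - m) r"
        using that by (auto simp: XDes_def Suc_diff_le split: if_splits)
      then show ?thesis using Dr by auto
    qed
    ultimately show "(\<lambda>(q, r). \<lambda>i\<in>{1..n}. if i \<le> m then q i else r (i - m)) y \<in> ?A"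
      unfolding y prod.case by blast
  qed
  \<comment> \<open>Both round trips rely on extensionality: restriction sets the values outside the
    index interval to \<open>undefined\<close>, where they already were.\<close>
  show "(\<lambda>(q, r). \<lambda>i\<in>{1..n}. if i \<le> m then q i else r (i - m)) (?f p) = p" if "p \<in> ?A" for p
  proof -
    have "p \<in> extensional {1..n}" using that words_extensional S by auto
    then show ?thesis using mn by (auto simp: fun_eq_iff extensional_def)
  qed
  show "?f ((\<lambda>(q, r). \<lambda>i\<in>{1..n}. if i \<le> m then q i else r (i - m)) y) = y" if "y \<in> ?B \<times> ?C" for y
  proof -
    obtain q r where y: "y = (q, r)" by fastforce
    have "q \<in> extensional {1..m}" "r \<in> extensional {1..n - m}"
      using that y words_extensional[of q T] words_extensional[of r "S - T"] T cST by auto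
    then show ?thesis using mn y by (auto simp: fun_eq_iff extensional_def)
  qed
qed

lemma dX_set_eq_dX:
  assumes "standardization_invariant X" "finite S" "S \<subseteq> {1..}"
  shows "dX_set X I S = dX X I (card S)"
proof -
  have "{1..card S} \<subseteq> {1::nat..}" by auto
  then show ?thesis
    using assms unfolding standardization_invariant_def dX_def
    by (metis card_atLeastAtMost diff_Suc_1 finite_atLeastAtMost)
qed

text \<open>Words are grouped by their exact descent set. This puts the count into the form of a sum
  over subsets that Moebius inversion takes as input.\<close>

lemma card_XDes_subset:
  assumes "finite S" "finite J"
  shows "card {p \<in> words S. XDes X (card S) p \<subseteq> J} = (\<Sum>K \<in> Pow J. dX_set X K S)"
proof -
  have "{p \<in> words S. XDes X (card S) p \<subseteq> J} =
      (\<Union>K \<in> Pow J. {p \<in> words S. XDes X (card S) p = K})" by auto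
  also have "card \<dots> = (\<Sum>K \<in> Pow J. dX_set X K S)"
    unfolding dX_set_def using assms finite_words[of S]
    by (subst card_UN_disjoint) auto
  finally show ?thesis .
qed

text \<open>Each word determines T as the set of its first m letters, so the words fall into
  disjoint classes, one for each of the (n choose m) sets T. All classes have the same size: c for
  the left half, and by invariance \<open>dX X {} (n - m)\<close> for the right half.\<close>

lemma card_XDes_subset_insert:
  assumes X: "standardization_invariant X" and S: "finite S" "S \<subseteq> {1..}" "card S = n"
    and m: "1 \<le> m" "m \<le> n" and J: "J \<subseteq> {1..<m}"
    and c: "\<And>T. finite T \<Longrightarrow> T \<subseteq> {1..} \<Longrightarrow> card T = m \<Longrightarrow>
      card {p \<in> words T. XDes X m p \<subseteq> J} = c"
  shows "card {p \<in> words S. XDes X n p \<subseteq> insert m J} = (n choose m) * c * dX X {} (n - m)"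
proof -
  let ?A = "\<lambda>T. {p \<in> words S. p ` {1..m} = T \<and> XDes X n p \<subseteq> insert m J}"
  let ?P = "{T. T \<subseteq> S \<and> card T = m}"
  have "p ` {1..m} \<in> ?P" if "p \<in> words S" for p
  proof -
    have b: "bij_betw p {1..n} S" using words_bij[OF that] S by simp
    moreover have "{1..m} \<subseteq> {1..n}" using m by auto
    ultimately have "inj_on p {1..m}" "p ` {1..m} \<subseteq> S"
      by (auto simp: bij_betw_def intro: inj_on_subset)
    then show ?thesis by (auto simp: card_image)
  qed
  then have "{p \<in> words S. XDes X n p \<subseteq> insert m J} = (\<Union>T \<in> ?P. ?A T)" by auto
  also have "card \<dots> = (\<Sum>T \<in> ?P. card (?A T))"
    using S finite_words[of S] by (subst card_UN_disjoint) auto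
  also have "\<dots> = (\<Sum>T \<in> ?P. c * dX X {} (n - m))"
  proof (rule sum.cong)
    fix T assume "T \<in> ?P"
    then have T: "T \<subseteq> S" "card T = m" by auto
    then have fT: "finite T" using S by (metis finite_subset)
    have cST: "card (S - T) = n - m" using S T fT by (simp add: card_Diff_subset)
    have "card (?A T) = card {q \<in> words T. XDes X m q \<subseteq> J}
        * card {r \<in> words (S - T). XDes X (n - m) r \<subseteq> {}}"
      using bij_betw_same_card[OF bij_betw_split_word[OF S(1) S(3) T m(1) J]]
      by (simp add: card_cartesian_product)
    also have "card {q \<in> words T. XDes X m q \<subseteq> J} = c"
      using c[OF fT _ T(2)] T S by auto
    also have "card {r \<in> words (S - T). XDes X (n - m) r \<subseteq> {}} = dX_set X {} (S - T)"
      using cST by (simp add: dX_set_def)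
    also have "\<dots> = dX X {} (n - m)"
      using dX_set_eq_dX[OF X, of "S - T"] S cST by auto
    finally show "card (?A T) = c * dX X {} (n - m)" .
  qed simp
  also have "\<dots> = (n choose m) * c * dX X {} (n - m)"
    using S n_subsets[of S m] by simp
  finally show ?thesis .
qed

text \<open>Induction removes the largest cut m from the end of the list. S and n are generalized
  because the left halves are words on arbitrary sets T of size m, not only on {1..m}.\<close>

lemma card_XDes_subset_prod:
  assumes X: "standardization_invariant X" and S: "finite S" "S \<subseteq> {1..}" "card S = n"
    and xs: "sorted_wrt (<) xs" "set xs \<subseteq> {1..<n}"
  shows "card {p \<in> words S. XDes X n p \<subseteq> set xs} =
    (\<Prod>t = 1..length xs. (0 # xs @ [n]) ! (t + 1) choose (0 # xs @ [n]) ! t)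
    * (\<Prod>t = 0..length xs. dX X {} ((0 # xs @ [n]) ! (t + 1) - (0 # xs @ [n]) ! t))"
  using S xs
proof (induction xs arbitrary: S n rule: rev_induct)
  case Nil
  then show ?case using dX_set_eq_dX[OF X, of S "{}"] by (simp add: dX_set_def)
next
  case (snoc m xs)
  define M where "M = 0 # xs @ [m]"
  define L where "L = 0 # (xs @ [m]) @ [n]"
  let ?r = "length xs"
  let ?c = "(\<Prod>t = 1..?r. M ! (t + 1) choose M ! t)
    * (\<Prod>t = 0..?r. dX X {} (M ! (t + 1) - M ! t))"
  have xs: "sorted_wrt (<) xs" "set xs \<subseteq> {1..<m}" and m: "1 \<le> m" "m < n"
    using snoc.prems by (auto simp: sorted_wrt_append)
  \<comment> \<open>L is M with n appended, so each product gains only the factor at t =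
    \<open>Suc ?r\<close>, built from the last two entries m and n.\<close>
  have LM: "L ! t = M ! t" if "t \<le> Suc ?r" for t
    using that nth_append[of M "[n]" t] by (auto simp: L_def M_def)
  have Ln: "L ! Suc (Suc ?r) = n" and Lm: "L ! Suc ?r = m"
    by (simp_all add: L_def nth_append)
  have "card {p \<in> words S. XDes X n p \<subseteq> insert m (set xs)} =
      (n choose m) * ?c * dX X {} (n - m)"
    using snoc.IH[OF _ _ _ xs, folded M_def] snoc.prems(1-3) m xs(2)
    by (intro card_XDes_subset_insert[OF X]) auto
  moreover have "(\<Prod>t = 1..Suc ?r. L ! (t + 1) choose L ! t) =
      (\<Prod>t = 1..?r. M ! (t + 1) choose M ! t) * (n choose m)"
    using Ln Lm by (simp add: LM)
  moreover have "(\<Prod>t = 0..Suc ?r. dX X {} (L ! (t + 1) - L ! t)) =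
      (\<Prod>t = 0..?r. dX X {} (M ! (t + 1) - M ! t)) * dX X {} (n - m)"
    using Ln Lm by (simp add: LM)
  ultimately show ?case unfolding L_def[symmetric] by simp
qed

theorem theorem2p3:
  fixes X :: "(nat \<times> nat) set" and I :: "nat set" and i :: "nat \<Rightarrow> nat" and k n :: nat
  assumes "standardization_invariant X"
    and "I \<subseteq> {1..n - 1}"
    and "Max (insert 0 I) \<le> n"
    and "I = i ` {1..k}" and "strict_mono_on {1..k} i"
    and "i 0 = 0" and "i (k + 1) = n"
  shows "int (dX X I n) =
    (\<Sum>J \<in> Pow {1..k}.
       let r = card J; j = padded_enum (k + 1) J in
       (- 1) ^ (k - r)
       * (\<Prod>t = 1..r. int (i (j (t + 1)) choose i (j t)))
       * (\<Prod>t = 0..r. int (dX X {} (i (j (t + 1)) - i (j t)))))"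
proof -
  let ?a = "\<lambda>J. card {p \<in> words {1..n}. XDes X n p \<subseteq> J}"
  have inj: "inj_on i {1..k}" using assms(5) by (rule strict_mono_on_imp_inj_on)
  \<comment> \<open>Subsets of I are images of index sets J, and injectivity of i makes this
    correspondence bijective and preserves cardinalities, hence signs.\<close>
  have PI: "Pow I = (`) i ` Pow {1..k}" using assms(4) by (simp add: image_Pow_surj)
  have cI: "card I = k" using assms(4) inj by (simp add: card_image)
  have fI: "finite I" using assms(4) by simp
  have "int (dX X I n) = (\<Sum>J \<in> Pow I. (- 1) ^ (card I - card J) * int (?a J))"
    by (rule inclusion_exclusion_mobius[where f = "\<lambda>K. int (dX X K n)", OF _ fI])
      (use card_XDes_subset[of "{1..n}" _ X] in \<open>simp add: dX_def\<close>)
  also have "\<dots> = (\<Sum>J \<in> Pow {1..k}. (- 1) ^ (k - card (i ` J)) * int (?a (i ` J)))"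
    unfolding PI cI by (subst sum.reindex) (use inj in \<open>simp_all add: inj_on_image_Pow\<close>)
  also have "\<dots> = (\<Sum>J \<in> Pow {1..k}.
       let r = card J; j = padded_enum (k + 1) J in
       (- 1) ^ (k - r)
       * (\<Prod>t = 1..r. int (i (j (t + 1)) choose i (j t)))
       * (\<Prod>t = 0..r. int (dX X {} (i (j (t + 1)) - i (j t)))))"
  proof (rule sum.cong)
    fix J assume "J \<in> Pow {1..k}"
    then have J: "J \<subseteq> {1..k}" by simp
    then have fJ: "finite J" by (rule finite_subset) simp
    have cJ: "card (i ` J) = card J" using inj J by (metis card_image inj_on_subset)
    define xs where "xs = map i (sorted_list_of_set J)"
    have sxs: "set xs = i ` J" and lxs: "length xs = card J" using fJ by (simp_all add: xs_def)
    \<comment> \<open>Strict monotonicity of i lets the increasing list of indices be mapped to the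
      increasing list of cuts.\<close>
    have "sorted_wrt (\<lambda>x y. i x < i y) (sorted_list_of_set J)"
      by (rule sorted_wrt_mono_rel[OF _ strict_sorted_list_of_set])
        (use J fJ assms(5) in \<open>auto simp: strict_mono_on_def subset_iff\<close>)
    then have srt: "sorted_wrt (<) xs" by (simp add: xs_def sorted_wrt_map)
    have "i ` J \<subseteq> {1..n - 1}" using assms(2,4) J by blast
    then have "set xs \<subseteq> {1..<n}" unfolding sxs by fastforce
    note a = card_XDes_subset_prod[OF assms(1) _ _ _ srt this, of "{1..n}"]
    define L where "L = 0 # xs @ [n]"
    \<comment> \<open>The conventions i 0 = 0 and i (k + 1) = n send the padding 0 and k + 1 of the
      index list to the padding 0 and n of the cut list.\<close>
    have "L = map i (0 # sorted_list_of_set J @ [k + 1])"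
      using assms(6,7) by (simp add: L_def xs_def)
    then have L: "L ! t = i (padded_enum (k + 1) J t)" if "t \<le> Suc (card J)" for t
      unfolding padded_enum_def using that lxs fJ by (simp del: list.map map_append)
    have "?a (i ` J) = (\<Prod>t = 1..card J. i (padded_enum (k + 1) J (t + 1)) choose i (padded_enum (k + 1) J t))
       * (\<Prod>t = 0..card J. dX X {} (i (padded_enum (k + 1) J (t + 1)) - i (padded_enum (k + 1) J t)))"
      using a unfolding L_def[symmetric] sxs lxs by (simp add: L)
    then show "(- 1) ^ (k - card (i ` J)) * int (?a (i ` J)) =
      (let r = card J; j = padded_enum (k + 1) J in
       (- 1) ^ (k - r)
       * (\<Prod>t = 1..r. int (i (j (t + 1)) choose i (j t)))
       * (\<Prod>t = 0..r. int (dX X {} (i (j (t + 1)) - i (j t)))))"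
      by (simp add: Let_def cJ mult.assoc)
  qed simp
  finally show ?thesis .
qed

end
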